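(* The gap vector of a very ample polytope with normal facets need not be unimodal. Namely, let $a,b\ge 1$ be integers with $b>7a$. Then the polytope $\mathcal{Q}_{a,b}$ is very ample, all of its facets are normal, and its gap vector is not unimodal; more precisely, $\gamma(\mathcal{Q}_{a,b})_{4a+1}>\gamma(\mathcal{Q}_{a,b})_{4a+2}$ and $\gamma(\mathcal{Q}_{a,b})_{4a+3}>\gamma(\mathcal{Q}_{a,b})_{4a+2}$.
   Context: For a pair $\{i,j\}\subset\{1,2,3,4\}$, $i\ne j$, let $V(i,j)\in\mathbb{Z}^4$ be the vector with coordinates $i$ and $j$ equal to $1$ and the other two equal to $0$. The polytope $\mathcal{Q}_{a,b}$ is the convex hull in $\mathbb{Z}^4\times\mathbb{Z}$ (tensored with the reals) of the twelve points $(V(1,2),0),\ (V(1,2),1)$; $(V(2,3),0),\ (V(2,3),1)$; $(V(1,3),0),\ (V(1,3),1)$; $(V(4,1),0),\ (V(4,1),b)$; $(V(4,2),b+4a+2),\ (V(4,2),2b+4a+2)$; $(V(4,3),2b+11a+4),\ (V(4,3),3b+11a+4)$. A lattice polytope $\mathcal{P}$ is normal in a lattice $M$ (here $M=\mathbb{Z}^4\times\mathbb{Z}$) if for every positive integer $m$ every lattice point in $m\mathcal{P}$ is a sum of $m$ lattice points of $\mathcal{P}$; it is very ample in $M$ if this holds for every sufficiently large $m$. For a lattice polytope $\mathcal{P}$ in a lattice $M$, $Ehr_{\mathcal{P}}(j)$ is the number of lattice points in $j\mathcal{P}$, and $H_{\mathcal{P}}(j)$ is the number of points with first coordinate $j$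 in the semigroup generated by the lattice points of $\{1\}\times\mathcal{P}$. The gap vector is $\gamma(\mathcal{P})_j:=Ehr_{\mathcal{P}}(j)-H_{\mathcal{P}}(j)$, $j\ge 1$. It is unimodal if there is an index $i$ such that $\gamma(\mathcal{P})_1\le\dots\le\gamma(\mathcal{P})_i\ge\gamma(\mathcal{P})_{i+1}\ge\cdots$.
   Formalization: The inequality γ_{4a+3} > γ_{4a+2} and the non-unimodality of Q_{a,b} are claimed only for a ≥ 2; for a = 1 they fail, as the gap vector is 0, 11, 27, 42, 50, 45, 42, 28, 0, …, which is unimodal with γ_7 < γ_6. *)

theory Defs
  imports "HOL-Analysis.Analysis"
begin

definition lattice_polytope :: "'a::euclidean_space set \<Rightarrow> 'a set \<Rightarrow> bool" where
  "lattice_polytope M P \<longleftrightarrow> (\<exists>V. finite V \<and> V \<subseteq> M \<and> P = convex hull V)"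

definition dilate :: "nat \<Rightarrow> 'a::euclidean_space set \<Rightarrow> 'a set" where
  "dilate m P = (\<lambda>x. real m *\<^sub>R x) ` P"

text \<open>Every lattice point of \<open>m P\<close> is a sum of \<open>m\<close> (not necessarily distinct) lattice
  points of \<open>P\<close>.\<close>

definition integrally_closed_at :: "'a::euclidean_space set \<Rightarrow> 'a set \<Rightarrow> nat \<Rightarrow> bool" where
  "integrally_closed_at M P m \<longleftrightarrow>
     (\<forall>x \<in> dilate m P \<inter> M. \<exists>f. (\<forall>i<m. f i \<in> P \<inter> M) \<and> x = (\<Sum>i<m. f i))"

definition normal_polytope :: "'a::euclidean_space set \<Rightarrow> 'a set \<Rightarrow> bool" where
  "normal_polytope M P \<longleftrightarrow>
     lattice_polytope M P \<and> (\<forall>m\<ge>1. integrally_closed_at M P m)"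

definition very_ample :: "'a::euclidean_space set \<Rightarrow> 'a set \<Rightarrow> bool" where
  "very_ample M P \<longleftrightarrow>
     lattice_polytope M P \<and> (\<exists>m0. \<forall>m\<ge>m0. integrally_closed_at M P m)"

inductive_set generated_semigroup :: "'a::semigroup_add set \<Rightarrow> 'a set" for A where
  gen: "x \<in> A \<Longrightarrow> x \<in> generated_semigroup A"
| add: "x \<in> generated_semigroup A \<Longrightarrow> y \<in> generated_semigroup A \<Longrightarrow>
        x + y \<in> generated_semigroup A"

definition Ehr :: "'a::euclidean_space set \<Rightarrow> 'a set \<Rightarrow> nat \<Rightarrow> nat" where
  "Ehr M P j = card (dilate j P \<inter> M)"

definition Hilb :: "'a::euclidean_space set \<Rightarrow> 'a set \<Rightarrow> nat \<Rightarrow> nat" where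
  "Hilb M P j = card {z \<in> generated_semigroup ({1::real} \<times> (P \<inter> M)). fst z = real j}"

text \<open>Only the entries with index \<open>j \<ge> 1\<close> are meaningful.\<close>

definition gap_vector :: "'a::euclidean_space set \<Rightarrow> 'a set \<Rightarrow> nat \<Rightarrow> int" where
  "gap_vector M P j = int (Ehr M P j) - int (Hilb M P j)"

definition unimodal :: "(nat \<Rightarrow> int) \<Rightarrow> bool" where
  "unimodal g \<longleftrightarrow>
     (\<exists>i\<ge>1. (\<forall>j. 1 \<le> j \<and> j < i \<longrightarrow> g j \<le> g (Suc j)) \<and> (\<forall>j\<ge>i. g (Suc j) \<le> g j))"

text \<open>The lattice \<open>\<int>\<^sup>4 \<times> \<int>\<close>.\<close>

definition Z4Z :: "((real^4) \<times> real) set" where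
  "Z4Z = {x. \<forall>i. x $ i \<in> \<int>} \<times> \<int>"

text \<open>The index type \<open>4\<close> has the four elements \<open>1, 2, 3, 4\<close> (with \<open>4 = 0\<close>).\<close>

definition V :: "4 \<Rightarrow> 4 \<Rightarrow> real^4" where
  "V i j = (\<chi> k. if k = i \<or> k = j then 1 else 0)"

text \<open>For \<open>b > 7 a\<close> the gap vector of \<open>Q a b\<close> is
  \<open>\<gamma>\<^sub>m = (m choose 2) * (max 0 (4 a + 2 - m) + max 0 (7 a + 2 - m))\<close>.
  For \<open>a = 1\<close> this is \<open>0, 11, 27, 42, 50, 45, 42, 28, 0, 0, \<dots>\<close>, which is unimodal;
  \<open>\<gamma>\<close> increases from \<open>4 a + 2\<close> to \<open>4 a + 3\<close> exactly when \<open>a \<ge> 2\<close>.\<close>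

definition Q :: "nat \<Rightarrow> nat \<Rightarrow> ((real^4) \<times> real) set" where
  "Q a b = (let A = real a; B = real b in convex hull
     {(V 1 2, 0), (V 1 2, 1),
      (V 2 3, 0), (V 2 3, 1),
      (V 1 3, 0), (V 1 3, 1),
      (V 4 1, 0), (V 4 1, B),
      (V 4 2, B + 4 * A + 2), (V 4 2, 2 * B + 4 * A + 2),
      (V 4 3, 2 * B + 11 * A + 4), (V 4 3, 3 * B + 11 * A + 4)})"

end

theory Submission
  imports Defs
begin

text \<open>
  The polytope lies over the octahedron \<open>conv {V i j}\<close>, with a vertical segment above each of the six
  vertices.  A choice of nonnegative coefficients \<open>c\<close> on the vertices, with sum \<open>m\<close>, gives a vertical
  segment in the \<open>m\<close>-th dilate above \<open>x = \<Sum>e. c e *\<^sub>R vertex e\<close>.  Its height is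
  \<open>width b c = (m - x\<^sub>4) + b * x\<^sub>4\<close>, which depends on \<open>x\<close> and \<open>m\<close> only; its lower end varies with \<open>c\<close>.
  The full fibre above \<open>x\<close> is the union of these segments over real \<open>c\<close>, whereas the sums of \<open>m\<close>
  lattice points are the lattice points on the segments with integral \<open>c\<close>
  (\<open>sums_of_lattice_points_Q\<close>).

  The three diagonals of the octahedron have the common midpoint \<open>(1,1,1,1)/2\<close>, and exchanging mass between
  them is the only freedom in \<open>c\<close>.  If \<open>x\<close> is integral, then \<open>c\<close> is an integral part plus real multiples
  \<open>p, q, r\<close> of the diagonals with an integral total \<open>n\<close> (\<open>integral_decomposition\<close>).  The diagonals have
  the heights \<open>d' = 2 b + 11 a + 4\<close>, \<open>d = b + 4 a + 2\<close> and \<open>0\<close>.  So the question becomes whether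
  the translates of \<open>[0, w]\<close>, where \<open>w = width b c\<close>, by \<open>p d' + q d\<close> with natural \<open>p + q \<le> n\<close> cover
  all the integers in \<open>[0, n d' + w]\<close>.  They do when \<open>w + 1\<close> is at least \<open>d\<close> and \<open>d' - d\<close> (\<open>translates_cover\<close>).  The only
  failures occur for \<open>n = 1\<close> and \<open>x\<^sub>4 = 1\<close>, where \<open>w = m - 1 + b\<close>, so the two gaps have \<open>4 a + 2 - m\<close> and
  \<open>7 a + 2 - m\<close> points (with truncated subtraction).  There are \<open>m choose 2\<close> such \<open>x\<close>, and the formula
  \<open>gap_vector_Q\<close> follows.

  Since there are no gap points for \<open>m \<ge> 7 a + 2\<close>, the polytope is very ample.  After division by
  \<open>m\<close> every gap point lies in the relative interior of the polytope (\<open>gap_points_interior\<close>), hence on no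
  proper face, and for a point of a face any sum representation uses only points of that face.  So every
  proper face is normal.  Finally the formula drops from \<open>4 a + 1\<close> to \<open>4 a + 2\<close>, where the first gap
  closes.  From there on the second factor loses only \<open>1\<close> per step instead of \<open>2\<close>, and if \<open>a \<ge> 2\<close>, then
  the growth of the binomial coefficient outweighs this loss at the next step, which creates a valley.
\<close>

section \<open>The polytope as a family of vertical segments\<close>

datatype edge = E12 | E13 | E23 | E14 | E24 | E34

lemma UNIV_edge: "UNIV = {E12, E13, E23, E14, E24, E34}"
  by (auto intro: edge.exhaust)

instance edge :: finite
  by standard (simp add: UNIV_edge)

lemma sum_edge:
  "sum f (UNIV :: edge set) = f E12 + f E13 + f E23 + f E14 + f E24 + f E34"
  by (simp add: UNIV_edge add.assoc)

fun vertex :: "edge \<Rightarrow> real^4" where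
  "vertex E12 = V 1 2"
| "vertex E13 = V 1 3"
| "vertex E23 = V 2 3"
| "vertex E14 = V 4 1"
| "vertex E24 = V 4 2"
| "vertex E34 = V 4 3"

fun base :: "nat \<Rightarrow> nat \<Rightarrow> edge \<Rightarrow> nat" where
  "base a b E24 = b + 4 * a + 2"
| "base a b E34 = 2 * b + 11 * a + 4"
| "base a b e = 0"

fun len :: "nat \<Rightarrow> edge \<Rightarrow> nat" where
  "len b E12 = 1"
| "len b E13 = 1"
| "len b E23 = 1"
| "len b e = b"

definition width :: "nat \<Rightarrow> (edge \<Rightarrow> real) \<Rightarrow> real" where
  "width b c = (\<Sum>e\<in>UNIV. c e * real (len b e))"

text \<open>The point at height \<open>t\<close> above the lower end of the segment belonging to the coefficients \<open>c\<close>.\<close>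

definition point :: "nat \<Rightarrow> nat \<Rightarrow> (edge \<Rightarrow> real) \<Rightarrow> real \<Rightarrow> (real^4) \<times> real" where
  "point a b c t = (\<Sum>e\<in>UNIV. c e *\<^sub>R vertex e, (\<Sum>e\<in>UNIV. c e * real (base a b e)) + t)"

lemma fst_point:
  "fst (point a b c t) $ 1 = c E12 + c E13 + c E14"
  "fst (point a b c t) $ 2 = c E12 + c E23 + c E24"
  "fst (point a b c t) $ 3 = c E13 + c E23 + c E34"
  "fst (point a b c t) $ 4 = c E14 + c E24 + c E34"
  by (simp_all add: point_def sum_edge V_def)

lemma snd_point:
  "snd (point a b c t) = c E24 * (b + 4 * a + 2) + c E34 * (2 * b + 11 * a + 4) + t"
  by (simp add: point_def sum_edge)

lemma width_eq: "width b c = c E12 + c E13 + c E23 + b * (c E14 + c E24 + c E34)"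
  by (simp add: width_def sum_edge algebra_simps)

lemma point_add: "point a b c t + point a b c' t' = point a b (\<lambda>e. c e + c' e) (t + t')"
  by (simp add: point_def scaleR_add_left sum.distrib algebra_simps)

lemma point_scaleR: "r *\<^sub>R point a b c t = point a b (\<lambda>e. r * c e) (r * t)"
  by (simp add: point_def scaleR_sum_right sum_distrib_left algebra_simps)

lemma point_eqI:
  assumes "fst z $ 1 = c E12 + c E13 + c E14" "fst z $ 2 = c E12 + c E23 + c E24"
    "fst z $ 3 = c E13 + c E23 + c E34" "fst z $ 4 = c E14 + c E24 + c E34"
    "snd z = c E24 * (b + 4 * a + 2) + c E34 * (2 * b + 11 * a + 4) + t"
  shows "z = point a b c t"
  using assms by (simp add: prod_eq_iff vec_eq_iff forall_4 fst_point snd_point)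

definition segment :: "nat \<Rightarrow> nat \<Rightarrow> edge \<Rightarrow> ((real^4) \<times> real) set" where
  "segment a b e = {vertex e} \<times> {real (base a b e)..real (base a b e + len b e)}"

lemma segment_eq_hull:
  "segment a b e = convex hull {(vertex e, real (base a b e)), (vertex e, real (base a b e + len b e))}"
  using convex_hull_Times[of "{vertex e}" "{real (base a b e), real (base a b e + len b e)}"]
  by (simp add: segment_def closed_segment_eq_real_ivl flip: segment_convex_hull)

lemma Q_segments: "Q a b = convex hull (\<Union>e. segment a b e)"
proof -
  let ?S = "{(V 1 2, 0), (V 1 2, 1),
      (V 2 3, 0), (V 2 3, 1),
      (V 1 3, 0), (V 1 3, 1),
      (V 4 1, 0), (V 4 1, real b),
      (V 4 2, real b + 4 * real a + 2), (V 4 2, 2 * real b + 4 * real a + 2),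
      (V 4 3, 2 * real b + 11 * real a + 4), (V 4 3, 3 * real b + 11 * real a + 4)}"
  have Q: "Q a b = convex hull ?S"
    by (simp add: Q_def Let_def)
  have S: "?S = (\<Union>e. {(vertex e, real (base a b e)), (vertex e, real (base a b e + len b e))})"
    by (auto simp: UNIV_edge algebra_simps)
  have "?S \<subseteq> (\<Union>e. segment a b e)"
    unfolding S segment_def by auto
  moreover have "segment a b e \<subseteq> convex hull ?S" for e
    unfolding segment_eq_hull by (rule hull_mono) (unfold S, auto)
  ultimately show ?thesis
    unfolding Q by (intro equalityI hull_mono hull_minimal UN_least convex_convex_hull)
qed


text \<open>Each vertical segment is convex, so a point of the hull needs only one point from each of them, and
  the heights above the lower ends accumulate to a single number \<open>t\<close>.\<close>

lemma Q_eq_points: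
  "Q a b = {point a b c t | c t. (\<forall>e. 0 \<le> c e) \<and> sum c UNIV = 1 \<and> 0 \<le> t \<and> t \<le> width b c}"
  (is "_ = ?R")
proof -
  have "convex (segment a b e) \<and> segment a b e \<noteq> {}" for e
    by (simp add: segment_def convex_Times)
  then have hull: "Q a b = {\<Sum>e\<in>UNIV. c e *\<^sub>R s e | c s.
      (\<forall>e\<in>UNIV. 0 \<le> c e) \<and> sum c UNIV = 1 \<and> (\<forall>e\<in>UNIV. s e \<in> segment a b e)}"
    unfolding Q_segments by (intro convex_hull_finite_union) auto
  have *: "(\<Sum>e\<in>UNIV. c e *\<^sub>R (vertex e, real (base a b e) + u e)) =
      point a b c (\<Sum>e\<in>UNIV. c e * u e)" for c u
    by (simp add: point_def prod_eq_iff fst_sum snd_sum algebra_simps sum.distrib)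
  show ?thesis
  proof (intro equalityI subsetI)
    fix z assume "z \<in> Q a b"
    then obtain c s where c: "\<forall>e. 0 \<le> c e" "sum c UNIV = 1" "\<And>e. s e \<in> segment a b e"
      and z: "z = (\<Sum>e\<in>UNIV. c e *\<^sub>R s e)"
      unfolding hull by auto
    define u where "u e = snd (s e) - real (base a b e)" for e
    have s: "s e = (vertex e, real (base a b e) + u e)" and u: "0 \<le> u e" "u e \<le> len b e" for e
      using c(3)[of e] by (auto simp: segment_def u_def prod_eq_iff mem_Times_iff)
    have "z = point a b c (\<Sum>e\<in>UNIV. c e * u e)"
      unfolding z s * ..
    moreover have "0 \<le> (\<Sum>e\<in>UNIV. c e * u e)" "(\<Sum>e\<in>UNIV. c e * u e) \<le> width b c"
      using c(1) u unfolding width_def by (auto intro!: sum_nonneg sum_mono mult_left_mono)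
    ultimately show "z \<in> ?R"
      using c by blast
  next
    fix z assume "z \<in> ?R"
    then obtain c t where z: "z = point a b c t" and c: "\<forall>e. 0 \<le> c e" "sum c UNIV = 1"
      and t: "0 \<le> t" "t \<le> width b c" by blast
    \<comment> \<open>Spread \<open>t\<close> proportionally over the segments; if the width is \<open>0\<close>, then \<open>t = 0\<close> and \<open>r = 0\<close> works.\<close>
    define r where "r = t / width b c"
    have r: "0 \<le> r" "r \<le> 1" "r * width b c = t"
      using t by (auto simp: r_def divide_le_eq_1)
    have "t = (\<Sum>e\<in>UNIV. c e * (r * len b e))"
      using r(3) by (simp add: width_def sum_distrib_left algebra_simps)
    then have "z = (\<Sum>e\<in>UNIV. c e *\<^sub>R (vertex e, real (base a b e) + r * len b e))"
      unfolding z * by simp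
    moreover have "(vertex e, real (base a b e) + r * len b e) \<in> segment a b e" for e
      using r by (simp add: segment_def mult_left_le_one_le)
    ultimately show "z \<in> Q a b"
      unfolding hull using c
      by (intro CollectI exI[of _ c] exI[of _ "\<lambda>e. (vertex e, real (base a b e) + r * len b e)"]) simp
  qed
qed

lemma dilate_Q:
  assumes "m \<ge> 1"
  shows "dilate m (Q a b) = {point a b c t | c t.
    (\<forall>e. 0 \<le> c e) \<and> sum c UNIV = real m \<and> 0 \<le> t \<and> t \<le> width b c}" (is "_ = ?R")
proof (intro equalityI subsetI)
  fix z assume "z \<in> dilate m (Q a b)"
  then obtain y where y: "y \<in> Q a b" "z = real m *\<^sub>R y"
    unfolding dilate_def by blast
  then obtain c t where "y = point a b c t" and c: "\<forall>e. 0 \<le> c e" "sum c UNIV = 1"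
    and t: "0 \<le> t" "t \<le> width b c"
    unfolding Q_eq_points by blast
  then have z: "z = point a b (\<lambda>e. real m * c e) (real m * t)"
    using y by (simp add: point_scaleR)
  have "width b (\<lambda>e. real m * c e) = real m * width b c"
    by (simp add: width_def sum_distrib_left mult.assoc)
  moreover have "(\<Sum>e\<in>UNIV. real m * c e) = m"
    using c by (simp flip: sum_distrib_left)
  ultimately have "(\<forall>e. 0 \<le> real m * c e) \<and> (\<Sum>e\<in>UNIV. real m * c e) = m \<and> 0 \<le> real m * t \<and>
      real m * t \<le> width b (\<lambda>e. real m * c e)"
    using c t by (simp add: mult_left_mono)
  then show "z \<in> ?R"
    using z by blast
next
  fix z assume "z \<in> ?R"
  then obtain c t where z: "z = point a b c t" and c: "\<forall>e. 0 \<le> c e" "sum c UNIV = real m"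
    and t: "0 \<le> t" "t \<le> width b c" by blast
  have "width b (\<lambda>e. 1/m * c e) = 1/m * width b c"
    by (simp add: width_def sum_distrib_left mult.assoc)
  moreover have "(\<Sum>e\<in>UNIV. 1/m * c e) = 1"
    using c assms by (simp flip: sum_divide_distrib)
  ultimately have "(\<forall>e. 0 \<le> 1/m * c e) \<and> (\<Sum>e\<in>UNIV. 1/m * c e) = 1 \<and> 0 \<le> 1/m * t \<and>
      1/m * t \<le> width b (\<lambda>e. 1/m * c e)"
    using c t by (simp add: divide_right_mono)
  then have "(1/m) *\<^sub>R z \<in> Q a b"
    unfolding Q_eq_points z point_scaleR by blast
  then show "z \<in> dilate m (Q a b)"
    unfolding dilate_def using assms by (intro image_eqI[of _ _ "(1/m) *\<^sub>R z"]) auto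
qed

section \<open>Lattice points above the octahedron\<close>

lemma mem_Z4Z: "z \<in> Z4Z \<longleftrightarrow> fst z $ 1 \<in> \<int> \<and> fst z $ 2 \<in> \<int> \<and> fst z $ 3 \<in> \<int> \<and> fst z $ 4 \<in> \<int> \<and> snd z \<in> \<int>"
  by (cases z) (simp add: Z4Z_def forall_4)

lemma sub_min_Nats:
  fixes x y :: real
  assumes "x - y \<in> \<int>"
  shows "x - min x y \<in> \<nat>"
  using assms by (auto simp: min_def Nats_altdef2)

text \<open>The difference of the coefficients at opposite vertices is an integral combination of \<open>m\<close> and the
  coordinates of \<open>x\<close>, for instance \<open>c E12 - c E34 = x\<^sub>1 + x\<^sub>2 - m\<close>.  Hence subtracting the smaller of the two
  from both leaves natural numbers, and the fourth coordinate shows that what was subtracted has an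
  integral total.\<close>

lemma integral_decomposition:
  assumes c: "\<And>e. 0 \<le> c e" and m: "sum c UNIV = real m" and z: "point a b c t \<in> Z4Z"
  obtains k :: "edge \<Rightarrow> nat" and n :: nat and p q r :: real
  where "0 \<le> p" "0 \<le> q" "0 \<le> r" "p + q + r = n"
    "c E12 = k E12 + p" "c E34 = k E34 + p" "c E13 = k E13 + q" "c E24 = k E24 + q"
    "c E23 = k E23 + r" "c E14 = k E14 + r" "sum k UNIV + 2 * n = m"
proof -
  define p where "p = min (c E12) (c E34)"
  define q where "q = min (c E13) (c E24)"
  define r where "r = min (c E23) (c E14)"
  have x: "c E12 + c E13 + c E14 \<in> \<int>" "c E12 + c E23 + c E24 \<in> \<int>"
    "c E13 + c E23 + c E34 \<in> \<int>" "c E14 + c E24 + c E34 \<in> \<int>"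
    using z by (simp_all add: mem_Z4Z fst_point)
  have m': "c E12 + c E13 + c E23 + c E14 + c E24 + c E34 = m"
    using m by (simp add: sum_edge)
  have d12: "c E12 - c E34 = (c E12 + c E13 + c E14) + (c E12 + c E23 + c E24) - m"
    and d13: "c E13 - c E24 = (c E12 + c E13 + c E14) + (c E13 + c E23 + c E34) - m"
    and d23: "c E23 - c E14 = (c E12 + c E23 + c E24) + (c E13 + c E23 + c E34) - m"
    using m' by simp_all
  have d: "c E12 - c E34 \<in> \<int>" "c E13 - c E24 \<in> \<int>" "c E23 - c E14 \<in> \<int>"
    unfolding d12 d13 d23 by (intro Ints_add Ints_diff x Ints_of_nat)+
  then have d': "c E34 - c E12 \<in> \<int>" "c E24 - c E13 \<in> \<int>" "c E14 - c E23 \<in> \<int>"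
    using Ints_minus[of "c E12 - c E34"] Ints_minus[of "c E13 - c E24"]
      Ints_minus[of "c E23 - c E14"] by simp_all
  have N: "c E12 - p \<in> \<nat>" "c E34 - p \<in> \<nat>" "c E13 - q \<in> \<nat>" "c E24 - q \<in> \<nat>"
    "c E23 - r \<in> \<nat>" "c E14 - r \<in> \<nat>"
    using d[THEN sub_min_Nats] d'[THEN sub_min_Nats] by (simp_all add: p_def q_def r_def min.commute)
  obtain k12 where k12: "c E12 - p = of_nat k12" using N(1) by (rule Nats_cases)
  obtain k34 where k34: "c E34 - p = of_nat k34" using N(2) by (rule Nats_cases)
  obtain k13 where k13: "c E13 - q = of_nat k13" using N(3) by (rule Nats_cases)
  obtain k24 where k24: "c E24 - q = of_nat k24" using N(4) by (rule Nats_cases)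
  obtain k23 where k23: "c E23 - r = of_nat k23" using N(5) by (rule Nats_cases)
  obtain k14 where k14: "c E14 - r = of_nat k14" using N(6) by (rule Nats_cases)
  note k' = k12 k34 k13 k24 k23 k14
  have pos: "0 \<le> p" "0 \<le> q" "0 \<le> r"
    using c by (simp_all add: p_def q_def r_def)
  have "p + q + r = (c E14 + c E24 + c E34) - (k14 + k24 + k34)"
    using k' by simp
  also have "\<dots> \<in> \<int>"
    using x by (intro Ints_diff) auto
  finally have "p + q + r \<in> \<nat>"
    using pos by (simp add: Nats_altdef2)
  then obtain n :: nat where n: "p + q + r = n"
    by (rule Nats_cases)
  define k where "k e = (case e of E12 \<Rightarrow> k12 | E13 \<Rightarrow> k13 | E23 \<Rightarrow> k23 | E14 \<Rightarrow> k14
    | E24 \<Rightarrow> k24 | E34 \<Rightarrow> k34)" for e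
  have "real (sum k UNIV + 2 * n) = real m"
    using m' k' n by (simp add: sum_edge k_def)
  then have "sum k UNIV + 2 * n = m"
    by linarith
  then show ?thesis
    using that[of p q r n k] pos n k' by (simp add: k_def)
qed

lemma point_unit: "point a b (\<lambda>e'. of_bool (e' = e)) t = (vertex e, real (base a b e) + t)"
  and width_unit: "width b (\<lambda>e'. of_bool (e' = e)) = len b e"
  by (cases e; simp add: point_def width_def sum_edge)+

text \<open>For \<open>m = 1\<close> no diagonal fits into the integral decomposition, so the coefficients of a lattice
  point are those of a single vertex.\<close>

lemma lattice_points_Q:
  "Q a b \<inter> Z4Z = {(vertex e, real (base a b e + s)) | e s. s \<le> len b e}" (is "_ = ?R")
proof (intro equalityI subsetI)
  fix z assume z: "z \<in> Q a b \<inter> Z4Z"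
  then obtain c t where zc: "z = point a b c t" and c: "\<And>e. 0 \<le> c e" "sum c UNIV = real 1"
    and t: "0 \<le> t" "t \<le> width b c"
    unfolding Q_eq_points by auto
  have "point a b c t \<in> Z4Z"
    using z zc by simp
  then obtain k :: "edge \<Rightarrow> nat" and n :: nat and p q r :: real where k: "0 \<le> p" "0 \<le> q" "0 \<le> r" "p + q + r = real n"
    "c E12 = k E12 + p" "c E34 = k E34 + p" "c E13 = k E13 + q" "c E24 = k E24 + q"
    "c E23 = k E23 + r" "c E14 = k E14 + r" "sum k UNIV + 2 * n = 1"
    by (rule integral_decomposition[OF c])
  have "n = 0"
    using k(11) by simp
  then have "p = 0" "q = 0" "r = 0"
    using k(1-4) by auto
  then have ck: "c e = k e" for e
    using k(5-10) by (cases e) simp_all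
  have "sum k UNIV = 1"
    using k(11) \<open>n = 0\<close> by simp
  then have "\<exists>e\<in>UNIV. k e = 1 \<and> (\<forall>e'\<in>UNIV. e \<noteq> e' \<longrightarrow> k e' = 0)"
    by (subst (asm) sum_eq_1_iff) simp_all
  then obtain e where "k e = 1" "\<And>e'. e \<noteq> e' \<Longrightarrow> k e' = 0"
    by blast
  then have c': "c = (\<lambda>e'. of_bool (e' = e))"
    by (auto simp: ck fun_eq_iff)
  have "snd z - real (base a b e) = t"
    unfolding zc c' point_unit by simp
  moreover have "snd z - real (base a b e) \<in> \<int>"
    using z by (auto simp: mem_Z4Z)
  ultimately have "t \<in> \<nat>"
    using t by (simp add: Nats_altdef2)
  then obtain s where "t = real s"
    by (rule Nats_cases)
  then show "z \<in> ?R"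
    using t unfolding zc c' point_unit width_unit by auto
next
  fix z assume "z \<in> ?R"
  then obtain e s where z: "z = (vertex e, real (base a b e + s))" and s: "s \<le> len b e"
    by blast
  have "z = point a b (\<lambda>e'. of_bool (e' = e)) (real s)"
    unfolding z point_unit by simp
  moreover have "sum (\<lambda>e'. of_bool (e' = e)) (UNIV::edge set) = (1::real)"
    by (cases e) (simp_all add: sum_edge)
  moreover have "real s \<le> width b (\<lambda>e'. of_bool (e' = e))"
    unfolding width_unit using s by simp
  ultimately have "z \<in> Q a b"
    unfolding Q_eq_points
    by (intro CollectI exI[of _ "\<lambda>e'. of_bool (e' = e)"] exI[of _ "real s"]) simp
  moreover have "z \<in> Z4Z"
    unfolding z by (cases e) (auto simp: mem_Z4Z V_def)
  ultimately show "z \<in> Q a b \<inter> Z4Z"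
    by blast
qed

section \<open>Sums of lattice points\<close>

definition sums_of :: "'a::comm_monoid_add set \<Rightarrow> nat \<Rightarrow> 'a set" where
  "sums_of S m = {\<Sum>i<m. f i | f. \<forall>i<m. f i \<in> S}"

lemma sums_of_0 [simp]: "sums_of S 0 = {0}"
  by (simp add: sums_of_def)

lemma sums_of_Suc: "sums_of S (Suc m) = {x + y | x y. x \<in> sums_of S m \<and> y \<in> S}"
proof (intro equalityI subsetI)
  fix z assume "z \<in> {x + y | x y. x \<in> sums_of S m \<and> y \<in> S}"
  then obtain f y where "z = (\<Sum>i<m. f i) + y" "\<forall>i<m. f i \<in> S" "y \<in> S"
    by (auto simp: sums_of_def)
  then show "z \<in> sums_of S (Suc m)"
    unfolding sums_of_def by (intro CollectI exI[of _ "f(m := y)"]) (auto simp: less_Suc_eq)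
next
  fix z assume "z \<in> sums_of S (Suc m)"
  then obtain f where "z = (\<Sum>i<m. f i) + f m" "\<forall>i<m. f i \<in> S" "f m \<in> S"
    by (auto simp: sums_of_def)
  then show "z \<in> {x + y | x y. x \<in> sums_of S m \<and> y \<in> S}"
    unfolding sums_of_def by blast
qed

lemma sums_of_add:
  "x \<in> sums_of S k \<Longrightarrow> y \<in> sums_of S l \<Longrightarrow> x + y \<in> sums_of S (k + l)"
proof (induction l arbitrary: y)
  case (Suc l)
  then obtain u v where "y = u + v" "u \<in> sums_of S l" "v \<in> S"
    by (auto simp: sums_of_Suc)
  moreover from this Suc have "x + u \<in> sums_of S (k + l)" by blast
  ultimately show ?case
    by (auto simp: sums_of_Suc simp flip: add.assoc)
qed simp

lemma integrally_closed_at_iff: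
  "integrally_closed_at M P m \<longleftrightarrow> dilate m P \<inter> M \<subseteq> sums_of (P \<inter> M) m"
  by (auto simp: integrally_closed_at_def sums_of_def)

lemma generated_semigroup_level:
  "generated_semigroup ({1::real} \<times> S) = {(real m, z) | m z. m \<ge> 1 \<and> z \<in> sums_of S m}"
proof (intro equalityI subsetI)
  fix y assume "y \<in> generated_semigroup ({1::real} \<times> S)"
  then show "y \<in> {(real m, z) | m z. m \<ge> 1 \<and> z \<in> sums_of S m}"
  proof induction
    case (gen x)
    then show ?case
      by (intro CollectI exI[of _ 1] exI[of _ "snd x"]) (auto simp: sums_of_Suc)
  next
    case (add x y)
    then obtain k u l v where "x = (real k, u)" "y = (real l, v)" "k \<ge> 1" "l \<ge> 1"
      "u \<in> sums_of S k" "v \<in> sums_of S l"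
      by blast
    then show ?case
      by (intro CollectI exI[of _ "k + l"] exI[of _ "u + v"]) (simp add: sums_of_add)
  qed
next
  have *: "z \<in> sums_of S (Suc m) \<Longrightarrow> (real (Suc m), z) \<in> generated_semigroup ({1} \<times> S)" for m z
  proof (induction m arbitrary: z)
    case 0
    then show ?case
      by (auto simp: sums_of_Suc intro: generated_semigroup.gen)
  next
    case (Suc m)
    obtain x y where z: "z = x + y" "x \<in> sums_of S (Suc m)" "y \<in> S"
      using Suc.prems unfolding sums_of_Suc[of S "Suc m"] by blast
    have "(real (Suc m), x) + (1, y) \<in> generated_semigroup ({1} \<times> S)"
      by (intro generated_semigroup.add Suc.IH z generated_semigroup.gen) (simp add: z)
    then show ?case
      by (simp add: z add.commute)
  qed
  fix y assume "y \<in> {(real m, z) | m z. m \<ge> 1 \<and> z \<in> sums_of S m}"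
  then show "y \<in> generated_semigroup ({1} \<times> S)"
    using * by (auto simp: gr0_conv_Suc Suc_le_eq)
qed

lemma Hilb_eq:
  assumes "m \<ge> 1"
  shows "Hilb M P m = card (sums_of (P \<inter> M) m)"
proof -
  have "{z \<in> generated_semigroup ({1} \<times> (P \<inter> M)). fst z = real m} = Pair (real m) ` sums_of (P \<inter> M) m"
    unfolding generated_semigroup_level using assms by auto
  then show ?thesis
    by (simp add: Hilb_def card_image inj_on_def)
qed

text \<open>The lower ends are linear in the coefficients, so a sum of \<open>m\<close> lattice points only records how often
  each vertex occurs and the total height above the lower ends; conversely any total height within the
  available width can be distributed greedily over the segments used.\<close>

lemma sums_of_lattice_points_Q:
  "sums_of (Q a b \<inter> Z4Z) m = {point a b (\<lambda>e. real (k e)) (real s) | k s.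
     sum k UNIV = m \<and> real s \<le> width b (\<lambda>e. real (k e))}" (is "_ = ?R m")
proof (induction m)
  case 0
  show ?case
  proof (intro equalityI subsetI)
    fix z assume "z \<in> sums_of (Q a b \<inter> Z4Z) 0"
    then show "z \<in> ?R 0"
      by (intro CollectI exI[of _ "\<lambda>_. 0"] exI[of _ 0]) (simp add: point_def width_def zero_prod_def)
  qed (auto simp: point_def width_def zero_prod_def)
next
  case (Suc m)
  have unit: "(vertex e, real (base a b e + s)) = point a b (\<lambda>e'. of_bool (e' = e)) (real s)" for e s
    by (simp add: point_unit)
  have add: "width b (\<lambda>e'. x e' + of_bool (e' = e)) = width b x + len b e" for x e
    by (cases e) (simp_all add: width_eq algebra_simps)
  show ?case
  proof (intro equalityI subsetI)
    fix z assume "z \<in> sums_of (Q a b \<inter> Z4Z) (Suc m)"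
    then obtain k s e s' where k: "sum k UNIV = m" "real s \<le> width b (\<lambda>e. real (k e))" "s' \<le> len b e"
      and z: "z = point a b (\<lambda>e. real (k e)) (real s) + (vertex e, real (base a b e + s'))"
      unfolding sums_of_Suc Suc unfolding lattice_points_Q by blast
    let ?k = "\<lambda>e'. k e' + of_bool (e' = e)"
    have "z = point a b (\<lambda>e. real (?k e)) (real (s + s'))"
      unfolding z unit point_add by simp
    moreover have "sum ?k UNIV = Suc m"
      using k by (cases e) (simp_all add: sum_edge)
    moreover have "real (s + s') \<le> width b (\<lambda>e. real (?k e))"
      using k add[of k e] by simp
    ultimately show "z \<in> ?R (Suc m)"
      by (intro CollectI exI[of _ ?k] exI[of _ "s + s'"] conjI)
  next
    fix z assume "z \<in> ?R (Suc m)"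
    then obtain k s where z: "z = point a b (\<lambda>e. real (k e)) (real s)" and k: "sum k UNIV = Suc m"
      and s: "real s \<le> width b (\<lambda>e. real (k e))"
      by blast
    obtain e where e: "k e > 0"
      using k by (metis gr0I sum.neutral nat.distinct(1))
    define k' where "k' = k(e := k e - 1)"
    have kk': "k = (\<lambda>e'. k' e' + of_bool (e' = e))"
      using e by (auto simp: k'_def)
    have "sum k' UNIV + 1 = Suc m"
      using k unfolding kk' by (cases e) (simp_all add: sum_edge)
    then have k': "sum k' UNIV = m" by simp
    define s' where "s' = min s (len b e)"
    have w: "width b (\<lambda>e. real (k e)) = width b (\<lambda>e. real (k' e)) + len b e"
      using add[of k' e] by (simp add: kk')
    have "0 \<le> width b (\<lambda>e. real (k' e))"
      unfolding width_def by (intro sum_nonneg) simp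
    then have "real (s - s') \<le> width b (\<lambda>e. real (k' e))"
      using s w by (auto simp: s'_def min_def of_nat_diff)
    then have "point a b (\<lambda>e. real (k' e)) (real (s - s')) \<in> sums_of (Q a b \<inter> Z4Z) m"
      unfolding Suc using k' by blast
    moreover have "(vertex e, real (base a b e + s')) \<in> Q a b \<inter> Z4Z"
      unfolding lattice_points_Q by (auto simp: s'_def)
    moreover have "z = point a b (\<lambda>e. real (k' e)) (real (s - s')) + (vertex e, real (base a b e + s'))"
      unfolding unit point_add z kk' by (simp add: s'_def)
    ultimately show "z \<in> sums_of (Q a b \<inter> Z4Z) (Suc m)"
      unfolding sums_of_Suc by blast
  qed
qed

section \<open>The gap points\<close>

text \<open>The translations \<open>0, d, d', d' + d, 2 d', \<dots>\<close> already suffice: their consecutive differences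
  are \<open>d\<close> and \<open>d' - d\<close>.\<close>

lemma translates_cover:
  fixes d d' w t :: int
  assumes "d \<le> w + 1" "d' - d \<le> w + 1" "0 \<le> t" "t \<le> int n * d' + w"
  shows "\<exists>p q. p + q \<le> n \<and> int p * d' + int q * d \<le> t \<and> t \<le> int p * d' + int q * d + w"
  using assms(3,4)
proof (induction n arbitrary: t)
  case 0
  then show ?case by auto
next
  case (Suc n)
  show ?case
  proof (cases "t \<ge> d'")
    case True
    then obtain p q where "p + q \<le> n" "p * d' + q * d \<le> t - d'" "t - d' \<le> p * d' + q * d + w"
      using Suc.IH[of "t - d'"] Suc.prems by (auto simp: algebra_simps)
    then show ?thesis
      by (intro exI[of _ "Suc p"] exI[of _ q]) (auto simp: algebra_simps)
  next
    case False
    show ?thesis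
    proof (cases "t \<le> w")
      case True
      then show ?thesis
        using Suc.prems by (intro exI[of _ 0]) auto
    next
      case False
      then show ?thesis
        using \<open>\<not> t \<ge> d'\<close> assms by (intro exI[of _ 0] exI[of _ 1]) auto
    qed
  qed
qed

text \<open>Coefficients of an integral \<open>x\<close> in the open octahedron with \<open>x\<^sub>4 = 1\<close>.  The diagonal is placed at
  \<open>E14\<close> and \<open>E23\<close>, whose lower ends are at height \<open>0\<close>, so that \<open>t\<close> in \<open>point a b (gap_coeffs i j l) t\<close> is
  the absolute height.\<close>

definition gap_coeffs :: "nat \<Rightarrow> nat \<Rightarrow> nat \<Rightarrow> edge \<Rightarrow> real" where
  "gap_coeffs i j l e = (case e of E12 \<Rightarrow> real i | E13 \<Rightarrow> real j | E23 \<Rightarrow> real l + 1 | E14 \<Rightarrow> 1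
     | E24 \<Rightarrow> 0 | E34 \<Rightarrow> 0)"

lemma gap_coeffs_simps [simp]:
  "gap_coeffs i j l E12 = i" "gap_coeffs i j l E13 = j" "gap_coeffs i j l E23 = real l + 1"
  "gap_coeffs i j l E14 = 1" "gap_coeffs i j l E24 = 0" "gap_coeffs i j l E34 = 0"
  by (simp_all add: gap_coeffs_def)

text \<open>The two ranges for \<open>t\<close> are the integers left uncovered between the segments \<open>[0, w]\<close>,
  \<open>[d, d + w]\<close> and \<open>[d', d' + w]\<close> of the three diagonals, where \<open>w = m - 1 + b\<close>.\<close>

definition gap_points :: "nat \<Rightarrow> nat \<Rightarrow> nat \<Rightarrow> ((real^4) \<times> real) set" where
  "gap_points a b m = {point a b (gap_coeffs i j l) (real t) | i j l t. i + j + l + 2 = m \<and>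
     (m + b \<le> t \<and> t < b + 4 * a + 2 \<or> 2 * b + 4 * a + 2 + m \<le> t \<and> t < 2 * b + 11 * a + 4)}"

text \<open>The diagonal may be split into positive real parts \<open>p, q, r\<close>, and a height strictly between \<open>0\<close> and
  \<open>d'\<close> can then be reached with room to spare on both sides of the segment.\<close>

lemma gap_points_interior:
  assumes "z \<in> gap_points a b m"
  obtains c t where "z = point a b c t" "\<forall>e. 0 < c e" "sum c UNIV = real m" "0 < t" "t < width b c"
proof -
  define d :: real where "d = b + 4 * a + 2"
  define d' :: real where "d' = 2 * b + 11 * a + 4"
  define w :: real where "w = real m - 1 + b"
  obtain i j l :: nat and t :: nat where z: "z = point a b (gap_coeffs i j l) (real t)"
    and m: "i + j + l + 2 = m"
    and t: "m + b \<le> t \<and> t < b + 4 * a + 2 \<or> 2 * b + 4 * a + 2 + m \<le> t \<and> t < 2 * b + 11 * a + 4"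
    using assms unfolding gap_points_def by blast
  have t': "0 < real t" "real t < d'"
    using t m by (auto simp: d'_def)
  have d: "0 < d" "d < d'"
    by (simp_all add: d_def d'_def)
  have w: "w > 0"
    using m by (simp add: w_def)
  \<comment> \<open>Divide \<open>t\<close> as \<open>u * d' + u * w\<close>: the diagonals have to supply \<open>p * d' + q * d = u * d'\<close>.  A small
    enough \<open>q\<close> keeps both \<open>p\<close> and \<open>r\<close> positive.\<close>
  define u where "u = t / (d' + w)"
  have u: "0 < u" "u < 1" "u * (d' + w) = t"
    using t' d w by (simp_all add: u_def)
  define q where "q = min u (1 - u)"
  define p where "p = u - q * d / d'"
  define r where "r = 1 - p - q"
  have q: "0 < q" "q \<le> u" "q \<le> 1 - u"
    using u by (simp_all add: q_def)
  have "0 < q * d / d'" "q * d / d' < q"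
    using q d by (simp_all add: divide_less_eq)
  then have p: "0 < p" "0 < r"
    using q by (simp_all add: p_def r_def)
  define c where "c e = (case e of E12 \<Rightarrow> i + p | E13 \<Rightarrow> j + q | E23 \<Rightarrow> l + r | E14 \<Rightarrow> r
     | E24 \<Rightarrow> q | E34 \<Rightarrow> p)" for e
  have width: "width b c = w"
    using m by (auto simp: width_eq c_def r_def w_def algebra_simps)
  have "z = point a b c (u * w)"
  proof (rule point_eqI)
    have "p * d' = u * d' - q * d"
      using d by (simp add: p_def field_simps)
    then have "q * d + p * d' + u * w = t"
      using u(3) by (simp add: algebra_simps)
    then show "snd z = c E24 * (b + 4 * a + 2) + c E34 * (2 * b + 11 * a + 4) + u * w"
      by (simp add: z snd_point c_def d_def d'_def)
  qed (simp_all add: z fst_point c_def r_def)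
  moreover have "\<forall>e. 0 < c e"
  proof
    show "0 < c e" for e
      using p q by (cases e) (simp_all add: c_def add_nonneg_pos)
  qed
  moreover have "sum c UNIV = real m"
    using m by (auto simp: sum_edge c_def r_def)
  moreover have "0 < u * w" "u * w < width b c"
    using u w by (simp_all add: width)
  ultimately show ?thesis
    by (rule that)
qed

lemma gap_points_subset:
  assumes "m \<ge> 1"
  shows "gap_points a b m \<subseteq> dilate m (Q a b) \<inter> Z4Z"
proof
  fix z assume z: "z \<in> gap_points a b m"
  then obtain c and t :: real where c: "z = point a b c t" "\<forall>e. 0 < c e" "sum c UNIV = real m" "0 < t" "t < width b c"
    by (rule gap_points_interior)
  then have "z \<in> dilate m (Q a b)"
    unfolding dilate_Q[OF assms] by (intro CollectI exI[of _ c] exI[of _ t]) (simp add: less_imp_le)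
  moreover have "z \<in> Z4Z"
    using z by (auto simp: gap_points_def mem_Z4Z fst_point snd_point)
  ultimately show "z \<in> dilate m (Q a b) \<inter> Z4Z"
    by blast
qed

text \<open>If \<open>x\<^sub>4 = 1\<close>, then natural coefficients use exactly one of the vertices \<open>E14\<close>, \<open>E24\<close>, \<open>E34\<close>, once,
  and this determines the lower end.\<close>

lemma gap_points_not_sums:
  "gap_points a b m \<inter> sums_of (Q a b \<inter> Z4Z) m = {}"
proof (rule ccontr)
  assume "\<not> ?thesis"
  then obtain z where z: "z \<in> gap_points a b m" "z \<in> sums_of (Q a b \<inter> Z4Z) m"
    by blast
  obtain i j l t where zg: "z = point a b (gap_coeffs i j l) (real t)"
    and t: "m + b \<le> t \<and> t < b + 4 * a + 2 \<or> 2 * b + 4 * a + 2 + m \<le> t \<and> t < 2 * b + 11 * a + 4"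
    using z(1) unfolding gap_points_def by blast
  obtain k s where zk: "z = point a b (\<lambda>e. real (k e)) (real s)" and k: "sum k UNIV = m"
    and s: "real s \<le> width b (\<lambda>e. real (k e))"
    using z(2) unfolding sums_of_lattice_points_Q by blast
  have "real (k E14 + k E24 + k E34) = 1"
    using fst_point(4)[of a b "\<lambda>e. real (k e)" "real s"]
    unfolding zk[symmetric] unfolding zg by (simp add: fst_point)
  then have k4: "k E14 + k E24 + k E34 = 1"
    by linarith
  have "real (k E24 * (b + 4 * a + 2) + k E34 * (2 * b + 11 * a + 4) + s) = real t"
    using snd_point[of a b "\<lambda>e. real (k e)" "real s"]
    unfolding zk[symmetric] unfolding zg by (simp add: snd_point algebra_simps)
  then have height: "k E24 * (b + 4 * a + 2) + k E34 * (2 * b + 11 * a + 4) + s = t"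
    by (rule of_nat_eq_iff[THEN iffD1])
  have "real s \<le> real (k E12 + k E13 + k E23 + b * (k E14 + k E24 + k E34))"
    using s by (simp add: width_eq)
  then have "s \<le> k E12 + k E13 + k E23 + b"
    unfolding k4 of_nat_le_iff by simp
  then have w: "s + 1 \<le> m + b"
    using k k4 by (simp add: sum_edge)
  from k4 consider "k E24 = 0" "k E34 = 0" | "k E24 = 1" "k E34 = 0" | "k E24 = 0" "k E34 = 1"
    by linarith
  then have "t = s \<or> t = b + 4 * a + 2 + s \<or> t = 2 * b + 11 * a + 4 + s"
    using height by cases simp_all
  then show False
    using t w by linarith
qed

text \<open>If the coordinate \<open>x\<^sub>4\<close> is at least \<open>2\<close>, the width is at least \<open>2 b\<close>, and \<open>b > 7 a\<close> makes this enough
  to bridge both \<open>d\<close> and \<open>d' - d\<close>.  Since \<open>n \<le> x\<^sub>4\<close>, an uncovered height leaves only \<open>n = x\<^sub>4 = 1\<close>.\<close>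

lemma lattice_points_dilate_Q:
  assumes ab: "7 * a < b" and m: "m \<ge> 1"
  shows "dilate m (Q a b) \<inter> Z4Z = sums_of (Q a b \<inter> Z4Z) m \<union> gap_points a b m"
proof (rule antisym)
  have "sums_of (Q a b \<inter> Z4Z) m \<subseteq> dilate m (Q a b) \<inter> Z4Z"
  proof
    fix z assume "z \<in> sums_of (Q a b \<inter> Z4Z) m"
    then obtain k s where z: "z = point a b (\<lambda>e. real (k e)) (real s)" and k: "sum k UNIV = m"
      and s: "real s \<le> width b (\<lambda>e. real (k e))"
      unfolding sums_of_lattice_points_Q by blast
    have "z \<in> dilate m (Q a b)"
      unfolding dilate_Q[OF m] using k s z
      by (intro CollectI exI[of _ "\<lambda>e. real (k e)"] exI[of _ "real s"]) (simp flip: of_nat_sum)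
    moreover have "z \<in> Z4Z"
      unfolding z by (simp add: mem_Z4Z fst_point snd_point)
    ultimately show "z \<in> dilate m (Q a b) \<inter> Z4Z"
      by blast
  qed
  then show "sums_of (Q a b \<inter> Z4Z) m \<union> gap_points a b m \<subseteq> dilate m (Q a b) \<inter> Z4Z"
    using gap_points_subset[OF m] by blast
next
  show "dilate m (Q a b) \<inter> Z4Z \<subseteq> sums_of (Q a b \<inter> Z4Z) m \<union> gap_points a b m"
  proof
    fix z assume z: "z \<in> dilate m (Q a b) \<inter> Z4Z"
    then obtain c and t :: real where zc: "z = point a b c t" and c: "\<And>e. 0 \<le> c e" "sum c UNIV = real m"
      and t: "0 \<le> t" "t \<le> width b c"
      unfolding dilate_Q[OF m] by auto
    have "point a b c t \<in> Z4Z"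
      using z zc by simp
    then obtain k :: "edge \<Rightarrow> nat" and n :: nat and p q r :: real where
      pqr: "0 \<le> p" "0 \<le> q" "0 \<le> r" "p + q + r = real n" and
      k: "c E12 = k E12 + p" "c E34 = k E34 + p" "c E13 = k E13 + q" "c E24 = k E24 + q"
        "c E23 = k E23 + r" "c E14 = k E14 + r" and kn: "sum k UNIV + 2 * n = m"
      by (rule integral_decomposition[OF c])
    define d :: int where "d = b + 4 * a + 2"
    define d' :: int where "d' = 2 * b + 11 * a + 4"
    define w :: int where "w = k E12 + k E13 + k E23 + n + b * (k E14 + k E24 + k E34 + n)"
    have width: "width b c = w"
    proof -
      have "width b c = k E12 + k E13 + k E23 + (p + q + r) + b * (k E14 + k E24 + k E34 + (p + q + r))"
        unfolding width_eq k by (simp add: algebra_simps)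
      then show ?thesis
        unfolding pqr(4) w_def by simp
    qed
    \<comment> \<open>The height above the contribution of the integral part \<open>k\<close>.\<close>
    define h where "h = q * d + p * d' + t"
    have h: "h = snd z - (k E24 * d + k E34 * d')"
      unfolding zc snd_point k h_def d_def d'_def by (simp add: algebra_simps)
    have "h \<in> \<int>"
      unfolding h using z by (intro Ints_diff) (auto simp: mem_Z4Z)
    then obtain t' :: int where t': "h = t'"
      by (rule Ints_cases)
    have dd': "0 < d" "d < d'"
      by (simp_all add: d_def d'_def)
    have "0 \<le> h"
      using pqr t dd' by (simp add: h_def)
    then have t'0: "0 \<le> t'"
      using t' by simp
    have "q * d \<le> q * d'" "0 \<le> r * d'"
      using pqr dd' by (auto intro: mult_left_mono)
    then have "h \<le> (p + q + r) * d' + w"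
      using t width by (simp add: h_def algebra_simps)
    then have "real_of_int t' \<le> real_of_int (int n * d' + w)"
      using t' pqr by simp
    then have t'w: "t' \<le> int n * d' + w"
      by linarith
    show "z \<in> sums_of (Q a b \<inter> Z4Z) m \<union> gap_points a b m"
    proof (cases "\<exists>p q. p + q \<le> n \<and> int p * d' + int q * d \<le> t' \<and> t' \<le> int p * d' + int q * d + w")
      case True
      then obtain p' q' where p': "p' + q' \<le> n" "int p' * d' + int q' * d \<le> t'"
        "t' \<le> int p' * d' + int q' * d + w" by blast
      define r' where "r' = n - p' - q'"
      define k' where "k' e = (case e of E12 \<Rightarrow> k E12 + p' | E13 \<Rightarrow> k E13 + q' | E23 \<Rightarrow> k E23 + r'
        | E14 \<Rightarrow> k E14 + r' | E24 \<Rightarrow> k E24 + q' | E34 \<Rightarrow> k E34 + p')" for e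
      define s where "s = nat (t' - int p' * d' - int q' * d)"
      have n: "n = p' + q' + r'"
        using p' by (simp add: r'_def)
      then have nr: "p + q + r = real p' + real q' + real r'"
        using pqr by simp
      have s: "real s = t' - real p' * d' - real q' * d"
        using p' by (simp add: s_def)
      have "z = point a b (\<lambda>e. real (k' e)) (real s)"
      proof (rule point_eqI)
        show "snd z = real (k' E24) * real (b + 4 * a + 2) + real (k' E34) * real (2 * b + 11 * a + 4)
            + real s"
          using h unfolding t' s by (simp add: k'_def d_def d'_def algebra_simps)
      qed (use nr in \<open>simp_all add: zc fst_point k k'_def\<close>)
      moreover have "sum k' UNIV = m"
        using kn n by (simp add: sum_edge k'_def)
      moreover have "real s \<le> width b (\<lambda>e. real (k' e))"
      proof -
        have "width b (\<lambda>e. real (k' e)) = w"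
          unfolding w_def n by (simp add: width_eq k'_def algebra_simps)
        moreover have "real s = real_of_int (t' - int p' * d' - int q' * d)"
          using s by simp
        moreover have "t' - int p' * d' - int q' * d \<le> w"
          using p' by simp
        ultimately show ?thesis
          by (simp only: of_int_le_iff)
      qed
      ultimately show ?thesis
        unfolding sums_of_lattice_points_Q by blast
    next
      case False
      then have uncovered: "\<not> (p + q \<le> n \<and> int p * d' + int q * d \<le> t' \<and>
          t' \<le> int p * d' + int q * d + w)" for p q
        by blast
      have "n \<noteq> 0"
        using uncovered[of 0 0] t'0 t'w by (cases n) auto
      moreover have "\<not> (d \<le> w + 1 \<and> d' - d \<le> w + 1)"
        using False translates_cover[of d w d' t' n] t'0 t'w by blast
      then have "\<not> 2 * b \<le> w"
        using ab by (auto simp: d_def d'_def)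
      then have "\<not> 2 \<le> k E14 + k E24 + k E34 + n"
        using mult_le_mono2[of 2 "k E14 + k E24 + k E34 + n" b] unfolding w_def by linarith
      ultimately have n: "n = 1" and k4: "k E14 = 0" "k E24 = 0" "k E34 = 0"
        by auto
      have km: "k E12 + k E13 + k E23 + 2 = m"
        using kn n k4 by (simp add: sum_edge)
      then have w: "w + 1 = m + b"
        by (simp add: w_def n k4)
      have "\<not> t' \<le> w" "\<not> (d \<le> t' \<and> t' \<le> d + w)" "\<not> (d' \<le> t' \<and> t' \<le> d' + w)"
        using uncovered[of 0 0] uncovered[of 0 1] uncovered[of 1 0] n t'0 by auto
      then have "m + b \<le> nat t' \<and> nat t' < b + 4 * a + 2 \<or>
          2 * b + 4 * a + 2 + m \<le> nat t' \<and> nat t' < 2 * b + 11 * a + 4"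
        using w t'0 t'w n by (auto simp: d_def d'_def)
      moreover have "z = point a b (gap_coeffs (k E12) (k E13) (k E23)) (real (nat t'))"
      proof (rule point_eqI)
        show "snd z = gap_coeffs (k E12) (k E13) (k E23) E24 * (b + 4 * a + 2) +
            gap_coeffs (k E12) (k E13) (k E23) E34 * (2 * b + 11 * a + 4) + real (nat t')"
          using h t' t'0 k4 by simp
      qed (use pqr(4) n in \<open>simp_all add: zc fst_point k k4\<close>)
      ultimately show ?thesis
        unfolding gap_points_def using km by blast
    qed
  qed
qed

section \<open>The gap vector\<close>

lemma card_pairs: "card {(i, j). i + j + 2 \<le> m} = m choose 2"
proof (induction m)
  case 0
  show ?case by simp
next
  case (Suc m)
  have split: "{(i, j). i + j + 2 \<le> Suc m} = {(i, j). i + j + 2 \<le> m} \<union> (\<lambda>i. (i, m - 1 - i)) ` {..<m}"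
    by auto
  have "{(i, j). i + j + 2 \<le> m} \<subseteq> {..m} \<times> {..m}"
    by auto
  then have "finite {(i, j). i + j + 2 \<le> m}"
    by (rule finite_subset) simp
  moreover have "card ((\<lambda>i. (i, m - 1 - i)) ` {..<m}) = m"
    by (subst card_image) (auto simp: inj_on_def)
  ultimately have "card {(i, j). i + j + 2 \<le> Suc m} = card {(i, j). i + j + 2 \<le> m} + m"
    unfolding split by (subst card_Un_disjoint) auto
  then show ?case
    unfolding Suc.IH by (simp add: numeral_2_eq_2)
qed

lemma card_gap_points:
  shows "finite (gap_points a b m)"
    and "card (gap_points a b m) = (m choose 2) * ((4 * a + 2 - m) + (7 * a + 2 - m))"
proof -
  let ?P = "{(i, j). i + j + 2 \<le> m}"
  let ?H = "{m + b..<b + 4 * a + 2} \<union> {2 * b + 4 * a + 2 + m..<2 * b + 11 * a + 4}"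
  let ?f = "\<lambda>((i, j), t). point a b (gap_coeffs i j (m - 2 - i - j)) (real t)"
  have eq: "gap_points a b m = ?f ` (?P \<times> ?H)"
  proof (intro equalityI subsetI)
    fix z assume "z \<in> gap_points a b m"
    then obtain i j l t where *: "z = point a b (gap_coeffs i j l) (real t)" "i + j + l + 2 = m" "t \<in> ?H"
      unfolding gap_points_def by auto
    then show "z \<in> ?f ` (?P \<times> ?H)"
      by (intro image_eqI[of _ _ "((i, j), t)"]) auto
  next
    fix z assume "z \<in> ?f ` (?P \<times> ?H)"
    then obtain i j t where *: "z = point a b (gap_coeffs i j (m - 2 - i - j)) (real t)" "i + j + 2 \<le> m" "t \<in> ?H"
      by auto
    then have "i + j + (m - 2 - i - j) + 2 = m" by simp
    then show "z \<in> gap_points a b m"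
      unfolding gap_points_def
      by (intro CollectI exI[of _ i] exI[of _ j] exI[of _ "m - 2 - i - j"] exI[of _ t] conjI)
        (use * in auto)
  qed
  have inj: "inj_on ?f (?P \<times> ?H)"
  proof (rule inj_onI)
    fix x x' assume "x \<in> ?P \<times> ?H" "x' \<in> ?P \<times> ?H" "?f x = ?f x'"
    moreover obtain i j t i' j' t' where x: "x = ((i, j), t)" "x' = ((i', j'), t')"
      by (metis surj_pair)
    ultimately have le: "i + j + 2 \<le> m" "i' + j' + 2 \<le> m"
      and "point a b (gap_coeffs i j (m - 2 - i - j)) (real t) =
        point a b (gap_coeffs i' j' (m - 2 - i' - j')) (real t')" (is "?z = ?z'")
      by simp_all
    then have "fst ?z $ 1 = fst ?z' $ 1" "fst ?z $ 2 = fst ?z' $ 2" "snd ?z = snd ?z'"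
      by simp_all
    then have "real (i + j) = real (i' + j')" "real (i + (m - 2 - i - j)) = real (i' + (m - 2 - i' - j'))"
      "t = t'"
      by (simp_all add: fst_point snd_point)
    then show "x = x'"
      using le unfolding of_nat_eq_iff x by auto
  qed
  have "finite ?P"
    by (rule finite_subset[of _ "{..m} \<times> {..m}"]) auto
  then show "finite (gap_points a b m)"
    unfolding eq by simp
  have "card ?H = (4 * a + 2 - m) + (7 * a + 2 - m)"
    by (subst card_Un_disjoint) auto
  then show "card (gap_points a b m) = (m choose 2) * ((4 * a + 2 - m) + (7 * a + 2 - m))"
    unfolding eq card_image[OF inj] card_cartesian_product card_pairs by simp
qed

lemma finite_sums_of: "finite S \<Longrightarrow> finite (sums_of S m)"
proof (induction m)
  case (Suc m)
  then have "finite ((\<lambda>(x, y). x + y) ` (sums_of S m \<times> S))"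
    by simp
  moreover have "sums_of S (Suc m) = (\<lambda>(x, y). x + y) ` (sums_of S m \<times> S)"
    by (auto simp: sums_of_Suc)
  ultimately show ?case
    by simp
qed simp

lemma finite_lattice_points_Q: "finite (Q a b \<inter> Z4Z)"
proof -
  have "Q a b \<inter> Z4Z = (\<Union>e. (\<lambda>s. (vertex e, real (base a b e + s))) ` {..len b e})"
    unfolding lattice_points_Q by auto
  then show ?thesis
    by simp
qed

lemma gap_vector_Q:
  assumes "7 * a < b" "m \<ge> 1"
  shows "gap_vector Z4Z (Q a b) m = int ((m choose 2) * ((4 * a + 2 - m) + (7 * a + 2 - m)))"
proof -
  have "Ehr Z4Z (Q a b) m = card (sums_of (Q a b \<inter> Z4Z) m) + card (gap_points a b m)"
    unfolding Ehr_def lattice_points_dilate_Q[OF assms]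
    using gap_points_not_sums[of a b m]
    by (intro card_Un_disjoint finite_sums_of finite_lattice_points_Q card_gap_points) blast
  then show ?thesis
    unfolding gap_vector_def Hilb_eq[OF assms(2)] card_gap_points(2) by simp
qed

section \<open>Very ampleness and normality of the faces\<close>

lemma lattice_polytope_Q: "lattice_polytope Z4Z (Q a b)"
  unfolding lattice_polytope_def Q_def Let_def
  by (intro exI conjI, rule_tac [3] refl) (auto simp: mem_Z4Z V_def)

lemma lattice_polytope_face:
  assumes "lattice_polytope M P" "F face_of P"
  shows "lattice_polytope M F"
proof -
  obtain S where S: "finite S" "S \<subseteq> M" "P = convex hull S"
    using assms(1) unfolding lattice_polytope_def by blast
  obtain S' where S': "S' \<subseteq> S" "F = convex hull S'"
    using face_of_convex_hull_subset[of S F] assms(2) S finite_imp_compact by blast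
  then have "finite S' \<and> S' \<subseteq> M \<and> F = convex hull S'"
    using S finite_subset[OF S'(1)] by simp
  then show ?thesis
    unfolding lattice_polytope_def ..
qed

lemma very_ample_Q:
  assumes "7 * a < b"
  shows "very_ample Z4Z (Q a b)"
  unfolding very_ample_def
proof (intro conjI lattice_polytope_Q exI[of _ "7 * a + 2"] allI impI)
  fix m assume m: "m \<ge> 7 * a + 2"
  then have "gap_points a b m = {}"
    by (auto simp: gap_points_def)
  then show "integrally_closed_at Z4Z (Q a b) m"
    using lattice_points_dilate_Q[OF assms, of m] m by (simp add: integrally_closed_at_iff)
qed

lemma face_of_convex_combination:
  fixes y :: "'i \<Rightarrow> 'a::real_vector"
  assumes F: "F face_of S" and S: "convex S" and I: "finite I" "j \<in> I"
    and u: "\<And>i. i \<in> I \<Longrightarrow> 0 < u i" "sum u I = 1" and y: "\<And>i. i \<in> I \<Longrightarrow> y i \<in> S"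
    and z: "(\<Sum>i\<in>I. u i *\<^sub>R y i) \<in> F"
  shows "y j \<in> F"
proof -
  define v where "v = sum u (I - {j})"
  have "u j + v = 1"
    using u(2) I by (simp add: v_def sum.remove)
  then have v: "u j = 1 - v"
    by simp
  show ?thesis
  proof (cases "I - {j} = {}")
    case True
    then have "I = {j}"
      using I by blast
    then show ?thesis
      using z u by simp
  next
    case False
    have "v > 0"
      unfolding v_def by (rule sum_pos) (use I False u in auto)
    define r where "r = (\<Sum>i\<in>I - {j}. (u i / v) *\<^sub>R y i)"
    have "r \<in> S"
      unfolding r_def
    proof (rule convex_sum)
      show "(\<Sum>i\<in>I - {j}. u i / v) = 1"
        using \<open>v > 0\<close> by (simp add: v_def flip: sum_divide_distrib)
    qed (use I S u y \<open>v > 0\<close> in \<open>auto simp: less_imp_le\<close>)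
    have "v *\<^sub>R r = (\<Sum>i\<in>I - {j}. u i *\<^sub>R y i)"
      using \<open>v > 0\<close> by (simp add: r_def scaleR_sum_right)
    then have sum: "(\<Sum>i\<in>I. u i *\<^sub>R y i) = u j *\<^sub>R y j + v *\<^sub>R r"
      using I by (simp add: sum.remove)
    show ?thesis
    proof (cases "y j = r")
      case True
      then have "(\<Sum>i\<in>I. u i *\<^sub>R y i) = y j"
        unfolding sum v by (simp add: scaleR_left_diff_distrib)
      then show ?thesis
        using z by simp
    next
      case False
      have "(\<Sum>i\<in>I. u i *\<^sub>R y i) \<in> open_segment (y j) r"
        unfolding in_segment sum v using False v \<open>v > 0\<close> u(1)[OF I(2)]
        by (intro conjI exI[of _ v]) auto
      then show ?thesis
        using F I y z \<open>r \<in> S\<close> unfolding face_of_def by blast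
    qed
  qed
qed

text \<open>A gap point has a representation with positive weight on both ends of all six segments, so a
  face through it contains all of them.\<close>

lemma face_with_gap_point:
  assumes b: "b > 0" and F: "F face_of Q a b" and y: "y \<in> F" and m: "m \<ge> 1"
    and gap: "real m *\<^sub>R y \<in> gap_points a b m"
  shows "F = Q a b"
proof -
  obtain c and t :: real where c: "real m *\<^sub>R y = point a b c t" "\<forall>e. 0 < c e" "sum c UNIV = real m"
    and t: "0 < t" "t < width b c"
    using gap by (rule gap_points_interior)
  have convex: "convex (Q a b)"
    by (simp add: Q_segments convex_convex_hull)
  define u where "u = t / width b c"
  have u: "0 < u" "u < 1" "u * width b c = t"
    using t by (simp_all add: u_def)
  define s where "s e = (vertex e, real (base a b e) + u * len b e)" for e
  define lo where "lo e = (vertex e, real (base a b e))" for e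
  define hi where "hi e = (vertex e, real (base a b e + len b e))" for e
  have lohi: "lo e \<in> Q a b" "hi e \<in> Q a b" for e
    using lattice_points_Q[of a b] unfolding lo_def hi_def by force+
  have s_eq: "s e = (\<Sum>i\<in>UNIV. (if i then u else 1 - u) *\<^sub>R (if i then hi e else lo e))" for e
    by (simp add: UNIV_bool s_def hi_def lo_def algebra_simps flip: scaleR_left_distrib)
  have sQ: "s e \<in> Q a b" for e
    unfolding s_eq by (rule convex_sum[OF _ convex]) (use u lohi in \<open>auto simp: UNIV_bool\<close>)
  have "point a b c t = (\<Sum>e\<in>UNIV. c e *\<^sub>R s e)"
    using u(3)
    by (simp add: point_def s_def prod_eq_iff fst_sum snd_sum sum.distrib width_def
        sum_distrib_left algebra_simps)
  moreover have "y = (1 / m) *\<^sub>R (real m *\<^sub>R y)"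
    using m by simp
  ultimately have "y = (1 / m) *\<^sub>R (\<Sum>e\<in>UNIV. c e *\<^sub>R s e)"
    unfolding c(1) by simp
  then have y_eq: "y = (\<Sum>e\<in>UNIV. (c e / m) *\<^sub>R s e)"
    by (simp add: scaleR_sum_right)
  have sF: "s e \<in> F" for e
  proof (rule face_of_convex_combination[OF F convex, where I = UNIV and u = "\<lambda>e. c e / m"])
    show "(\<Sum>e\<in>UNIV. (c e / m) *\<^sub>R s e) \<in> F"
      using y y_eq by simp
    show "(\<Sum>e\<in>UNIV. c e / m) = 1"
      using c(3) m by (simp flip: sum_divide_distrib)
  qed (use c m sQ in auto)
  have "(if i then hi e else lo e) \<in> F" for i e
  proof (rule face_of_convex_combination[OF F convex, where I = UNIV and
        u = "\<lambda>i. if i then u else 1 - u" and y = "\<lambda>i. if i then hi e else lo e"])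
    show "(\<Sum>i\<in>UNIV. (if i then u else 1 - u) *\<^sub>R (if i then hi e else lo e)) \<in> F"
      using sF[of e] unfolding s_eq .
  qed (use u lohi in \<open>auto simp: UNIV_bool\<close>)
  then have lohiF: "lo e \<in> F" "hi e \<in> F" for e
    by (metis (full_types))+
  have "segment a b e \<subseteq> F" for e
    unfolding segment_eq_hull using lohiF[of e] F
    by (intro hull_minimal) (auto simp: lo_def hi_def face_of_imp_convex)
  then have "Q a b \<subseteq> F"
    unfolding Q_segments using F by (intro hull_minimal) (auto simp: face_of_imp_convex)
  then show ?thesis
    using face_of_imp_subset[OF F] by blast
qed

lemma normal_proper_face:
  assumes ab: "7 * a < b" and F: "F face_of Q a b" "F \<noteq> Q a b"
  shows "normal_polytope Z4Z F"
  unfolding normal_polytope_def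
proof (intro conjI allI impI)
  show "lattice_polytope Z4Z F"
    using lattice_polytope_face[OF lattice_polytope_Q F(1)] .
  fix m :: nat assume m: "m \<ge> 1"
  show "integrally_closed_at Z4Z F m"
    unfolding integrally_closed_at_iff
  proof
    fix z assume "z \<in> dilate m F \<inter> Z4Z"
    then obtain y where y: "y \<in> F" "z = real m *\<^sub>R y" and z: "z \<in> Z4Z"
      by (auto simp: dilate_def)
    have "z \<in> dilate m (Q a b) \<inter> Z4Z"
      using y z face_of_imp_subset[OF F(1)] by (auto simp: dilate_def)
    moreover have "z \<notin> gap_points a b m"
      using face_with_gap_point[OF _ F(1) y(1) m] F(2) y(2) ab by auto
    ultimately have "z \<in> sums_of (Q a b \<inter> Z4Z) m"
      using lattice_points_dilate_Q[OF ab m] by blast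
    then obtain f where f: "\<And>i. i < m \<Longrightarrow> f i \<in> Q a b \<inter> Z4Z" "z = (\<Sum>i<m. f i)"
      unfolding sums_of_def by auto
    have "y = (1 / m) *\<^sub>R z"
      using y m by simp
    then have y_eq: "y = (\<Sum>i<m. (1 / m) *\<^sub>R f i)"
      by (simp add: f scaleR_sum_right)
    have "f i \<in> F" if "i < m" for i
    proof (rule face_of_convex_combination[OF F(1), where I = "{..<m}"])
      show "(\<Sum>i<m. (1 / m) *\<^sub>R f i) \<in> F"
        using y y_eq by simp
    qed (use f m that in \<open>auto simp: Q_segments convex_convex_hull\<close>)
    then show "z \<in> sums_of (F \<inter> Z4Z) m"
      using f unfolding sums_of_def by blast
  qed
qed

section \<open>Failure of unimodality\<close>

lemma not_unimodal_valley:
  assumes "1 \<le> j" "g j > g (Suc j)" "g (Suc (Suc j)) > g (Suc j)"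
  shows "\<not> unimodal g"
proof
  assume "unimodal g"
  then obtain i where i: "\<And>j. 1 \<le> j \<Longrightarrow> j < i \<Longrightarrow> g j \<le> g (Suc j)" "\<And>j. j \<ge> i \<Longrightarrow> g (Suc j) \<le> g j"
    unfolding unimodal_def by blast
  show False
    using i(1)[of j] i(2)[of "Suc j"] assms by (cases "j < i") auto
qed

theorem mainTheorem7:
  shows "(\<exists>P. very_ample Z4Z P \<and>
              (\<forall>F. F facet_of P \<longrightarrow> normal_polytope Z4Z F) \<and>
              \<not> unimodal (gap_vector Z4Z P)) \<and>
         (\<forall>a b :: nat. 1 \<le> a \<and> 1 \<le> b \<and> 7 * a < b \<longrightarrow>
              very_ample Z4Z (Q a b) \<and>
              (\<forall>F. F facet_of Q a b \<longrightarrow> normal_polytope Z4Z F) \<and>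
              gap_vector Z4Z (Q a b) (4 * a + 1) > gap_vector Z4Z (Q a b) (4 * a + 2) \<and>
              (2 \<le> a \<longrightarrow>
                 gap_vector Z4Z (Q a b) (4 * a + 3) > gap_vector Z4Z (Q a b) (4 * a + 2) \<and>
                 \<not> unimodal (gap_vector Z4Z (Q a b))))"
proof -
  have facets: "normal_polytope Z4Z F" if "7 * a < b" "F facet_of Q a b" for a b F
  proof -
    from that have "F face_of Q a b" "F \<noteq> Q a b"
      by (auto simp: facet_of_def)
    with that show ?thesis
      by (intro normal_proper_face)
  qed
  have choose: "2 * (Suc m choose 2) = Suc m * m" for m
    by (induction m) (simp_all add: numeral_2_eq_2 algebra_simps)
  \<comment> \<open>The comparisons are made after doubling, where the binomial coefficients become products.\<close>
  have desc: "gap_vector Z4Z (Q a b) (4 * a + 1) > gap_vector Z4Z (Q a b) (4 * a + 2)"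
    if "1 \<le> a" "7 * a < b" for a b
  proof -
    define C where "C = (4 * a + 1) choose 2"
    define D where "D = (4 * a + 2) choose 2"
    have CD: "2 * C = (4 * a + 1) * (4 * a)" "2 * D = (4 * a + 2) * (4 * a + 1)"
      using choose[of "4 * a"] choose[of "4 * a + 1"] by (simp_all add: C_def D_def)
    have "(2 * D) * (3 * a) < (2 * C) * (3 * a + 2)"
      unfolding CD using that(1) by (simp add: algebra_simps)
    then have "D * (3 * a) < C * (3 * a + 2)"
      by simp
    moreover have "(4 * a + 2 - (4 * a + 1)) + (7 * a + 2 - (4 * a + 1)) = 3 * a + 2"
      "(4 * a + 2 - (4 * a + 2)) + (7 * a + 2 - (4 * a + 2)) = 3 * a"
      by simp_all
    ultimately show ?thesis
      using gap_vector_Q[OF that(2), of "4 * a + 1"] gap_vector_Q[OF that(2), of "4 * a + 2"]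
      by (simp only: C_def D_def of_nat_less_iff)
  qed
  have asc: "gap_vector Z4Z (Q a b) (4 * a + 3) > gap_vector Z4Z (Q a b) (4 * a + 2)"
    if ab: "2 \<le> a" "7 * a < b" for a b
  proof -
    define D where "D = (4 * a + 2) choose 2"
    define E where "E = (4 * a + 3) choose 2"
    obtain a' where a': "a = 2 + a'"
      using le_Suc_ex[OF ab(1)] by auto
    have DE: "2 * D = (4 * a + 2) * (4 * a + 1)" "2 * E = (4 * a + 3) * (4 * a + 2)"
      using choose[of "4 * a + 1"] choose[of "4 * a + 2"]
      by (simp_all add: D_def E_def numeral_3_eq_3)
    have "(2 * D) * (3 * a) < (2 * E) * (3 * a - 1)"
      unfolding DE a' by (simp add: algebra_simps)
    then have "D * (3 * a) < E * (3 * a - 1)"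
      by simp
    moreover have "(4 * a + 2 - (4 * a + 2)) + (7 * a + 2 - (4 * a + 2)) = 3 * a"
      "(4 * a + 2 - (4 * a + 3)) + (7 * a + 2 - (4 * a + 3)) = 3 * a - 1"
      by simp_all
    ultimately show ?thesis
      using gap_vector_Q[OF that(2), of "4 * a + 2"] gap_vector_Q[OF that(2), of "4 * a + 3"]
      by (simp only: D_def E_def of_nat_less_iff)
  qed
  have not_unimodal: "\<not> unimodal (gap_vector Z4Z (Q a b))" if "2 \<le> a" "7 * a < b" for a b
    using desc[of a b] asc[of a b] that
    by (intro not_unimodal_valley[of "4 * a + 1"]) (simp_all add: numeral_3_eq_3)
  show ?thesis
  proof (intro conjI allI impI exI[of _ "Q 2 15"])
    show "very_ample Z4Z (Q 2 15)" "\<not> unimodal (gap_vector Z4Z (Q 2 15))"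
      by (rule very_ample_Q not_unimodal; simp)+
    show "normal_polytope Z4Z F" if "F facet_of Q 2 15" for F
      using that by (intro facets[of 2 15]) simp_all
  qed (use very_ample_Q facets desc asc not_unimodal in blast)+
qed

end
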